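(* Let $N>0$ be an integer. There is no integer $C$ such that for every integer $n\ge 0$ there exists an integer index $j\ge 0$ (depending on $n$ and $N$) with $$\sum_{i=0}^{2N} P(n+i) = C\cdot P(j).$$
   Context: The Pell numbers are defined by $P(0)=0$, $P(1)=1$ and $P(n)=2P(n-1)+P(n-2)$ for $n\ge 2$. *)

theory Defs
  imports Main
begin

fun pell :: "nat \<Rightarrow> int" where
  "pell 0 = 0"
| "pell (Suc 0) = 1"
| "pell (Suc (Suc n)) = 2 * pell (Suc n) + pell n"

end

theory Submission
  imports Defs
begin

text \<open>
  Write \<open>S n\<close> for the sum; it satisfies the Pell recurrence. If \<open>S 1 = C * P j\<close> and
  \<open>S 2 = C * P j'\<close>, then \<open>2 * S 1 < S 2 < 3 * S 1\<close> forces \<open>j' = j + 1\<close>, and running the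
  recurrence backwards gives \<open>S 0 = C * P (j - 1)\<close>. The quadratic form
  \<open>x\<^sup>2 - 2 * x * y - y\<^sup>2\<close> takes the value \<open>\<plusminus>1\<close> on consecutive Pell numbers, hence \<open>\<plusminus>C\<^sup>2\<close> on
  \<open>(S 1, S 0)\<close>. A direct computation shows that this value is also \<open>2 * S 0 + 1\<close>. As \<open>C\<close>
  divides \<open>S 0\<close>, it divides \<open>1\<close>, so \<open>2 * S 0 + 1 = \<plusminus>1\<close>, contradicting \<open>S 0 > 0\<close>.
\<close>

lemma pell_nonneg: "pell n \<ge> 0"
  by (induction n rule: pell.induct) auto

lemma pell_mono_Suc: "pell n \<le> pell (Suc n)"
  by (cases n rule: pell.cases) (auto simp: pell_nonneg add_increasing2)

lemma pell_mono: "m \<le> n \<Longrightarrow> pell m \<le> pell n"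
  by (rule lift_Suc_mono_le[of pell]) (auto intro: pell_mono_Suc)

lemma pell_pos: "n > 0 \<Longrightarrow> pell n > 0"
  using pell_mono[of 1 n] by simp

text \<open>The form changes sign under the recurrence map
  \<open>(x, y) \<mapsto> (2 * x + y, x)\<close>.\<close>

lemma pell_norm: "(pell (Suc n))\<^sup>2 - 2 * pell (Suc n) * pell n - (pell n)\<^sup>2 = (-1) ^ n"
proof (induction n)
  case (Suc n)
  then show ?case
    by (simp add: power2_eq_square algebra_simps)
qed simp

lemma sum_pell: "2 * (\<Sum>i = 0..m. pell i) + 1 = pell m + pell (Suc m)"
  by (induction m) auto

text \<open>By monotonicity, \<open>j' \<le> j\<close> would give
  \<open>pell j' \<le> pell j\<close>, and \<open>j' \<ge> j + 2\<close> would give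
  \<open>pell j' \<ge> 3 * pell j\<close>.\<close>

lemma pell_index_Suc:
  assumes "2 * pell j < pell j'" "pell j' < 3 * pell j"
  shows "j' = Suc j"
proof -
  have "j < j'"
    using assms(1) pell_nonneg[of j] pell_mono[of j' j] by linarith
  moreover have "pell (Suc (Suc j)) \<ge> 3 * pell j"
    using pell_mono_Suc[of j] by simp
  then have "j' < Suc (Suc j)"
    using assms(2) pell_mono[of "Suc (Suc j)" j'] by linarith
  ultimately show ?thesis by simp
qed

theorem theorem4p3:
  fixes N :: nat
  assumes "N > 0"
  shows "\<not> (\<exists>C :: int. \<forall>n :: nat. \<exists>j :: nat. (\<Sum>i = 0..2 * N. pell (n + i)) = C * pell j)"
proof
  define S where "S n = (\<Sum>i = 0..2 * N. pell (n + i))" for n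
  assume "\<exists>C :: int. \<forall>n. \<exists>j. (\<Sum>i = 0..2 * N. pell (n + i)) = C * pell j"
  then obtain C j j' where j: "S 1 = C * pell j" and j': "S 2 = C * pell j'"
    unfolding S_def by blast
  have rec: "S 2 = 2 * S 1 + S 0"
    by (simp add: S_def sum.distrib sum_distrib_left numeral_2_eq_2)
  have diff: "S 1 = S 0 + pell (Suc (2 * N))"
    using sum_Suc_diff[of 0 "2 * N" pell] by (simp add: S_def sum_subtractf)
  have S0: "2 * S 0 + 1 = pell (2 * N) + pell (Suc (2 * N))"
    using sum_pell[of "2 * N"] by (simp add: S_def)
  have "S 0 > 0"
    using S0 pell_pos[of "2 * N"] pell_pos[of "Suc (2 * N)"] \<open>N > 0\<close> by linarith
  have "S 0 < S 1"
    using diff pell_pos[of "Suc (2 * N)"] by simp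
  then have "C * pell j > 0"
    using \<open>S 0 > 0\<close> j by simp
  then have "C > 0" "pell j > 0"
    using pell_nonneg[of j] by (auto simp: zero_less_mult_iff)
  have "C * (2 * pell j) < C * pell j'" "C * pell j' < C * (3 * pell j)"
    using rec \<open>S 0 > 0\<close> \<open>S 0 < S 1\<close> j j' by (auto simp: algebra_simps)
  then have "j' = Suc j"
    using \<open>C > 0\<close> by (intro pell_index_Suc) simp_all
  obtain k where k: "j = Suc k"
    using \<open>pell j > 0\<close> by (cases j) auto
  have Ck: "S 0 = C * pell k"
    using rec j j' \<open>j' = Suc j\<close> k by (simp add: algebra_simps)

  have "(S 1)\<^sup>2 - 2 * S 1 * S 0 - (S 0)\<^sup>2 = C\<^sup>2 * (-1) ^ k"
    unfolding j Ck k pell_norm[of k, symmetric] by (simp add: power2_eq_square algebra_simps)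
  moreover have "(S 1)\<^sup>2 - 2 * S 1 * S 0 - (S 0)\<^sup>2 = 2 * S 0 + 1"
  proof -
    define x y where "x = pell (Suc (2 * N))" and "y = pell (2 * N)"
    \<comment> \<open>The norm is \<open>+1\<close> as \<open>2 * N\<close> is even; eliminating
      \<open>y\<close> gives \<open>x\<^sup>2 = 2 * (S 0)\<^sup>2 + 2 * S 0 + 1\<close>, while the
      form at \<open>(S 1, S 0)\<close> is \<open>x\<^sup>2 - 2 * (S 0)\<^sup>2\<close>.\<close>
    have "x\<^sup>2 - 2 * x * y - y\<^sup>2 = 1" "y = 2 * S 0 + 1 - x" "S 1 = S 0 + x"
      using pell_norm[of "2 * N"] S0 diff by (simp_all add: x_def y_def)
    then show ?thesis
      by (simp add: power2_eq_square algebra_simps)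
  qed
  ultimately have eq: "2 * S 0 + 1 = C\<^sup>2 * (-1) ^ k" by simp
  have "C dvd 2 * S 0 + 1"
    unfolding eq by (simp add: power2_eq_square)
  then have "C dvd 1"
    using Ck by (simp add: dvd_add_right_iff)
  then have "C = 1"
    using \<open>C > 0\<close> by simp
  then have "2 * S 0 + 1 \<le> 1"
    unfolding eq by (cases "even k") simp_all
  then show False
    using \<open>S 0 > 0\<close> by simp
qed

end
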